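(* The family of $\mathcal G_t$-networks (with bounded-degree representation) is not universal.
   Context: $\mathcal G$-networks. Let $Q$ be a finite alphabet and $\mathcal G$ a set of maps $g:Q^{i(g)}\to Q^{o(g)}$. A $\mathcal G$-network is an automata network $F:Q^V\to Q^V$ together with gates $g_1,\dots,g_n\in\mathcal G$ such that, with $I=\{(j,k):1\le k\le i(g_j)\}$ and $O=\{(j,k):1\le k\le o(g_j)\}$, $|V|=|I|=|O|$ and there are bijections $\alpha:I\to V$, $\beta:V\to O$ with no $(j,k)\in I$ satisfying $\beta(\alpha(j,k))=(j,k')$ for some $k'$, and for $v$ with $\beta(v)=(j,k)$: $F(x)_v=g_j(x_{\alpha(j,1)},\dots,x_{\alpha(j,i(g_j))})_k$. The family is represented by interaction graph plus local transition tables. $\mathcal G_t$: alphabet $Q=\{0,1,2\}$ and the maps $\mathrm{AND}_{\{0,1\}}(x,y)=2$ if $2\in\{x,y\}$ and $x\wedge y$ otherwise; $\mathrm{AND}_2(x,y)=2$ if $2\in\{x,y\}$ or $x=y=1$, and $0$ otherwise; $\Lambda(x,y)=2$ if $2\in\{x,y\}$ and $x$ otherwise; $\mathrm{Id}(x)=x$; $\Upsilon(x)=(x,x)$. Universality. For each finite alphabet fix an injective $m_Q:Q\to\{0,1\}^{k_Q}$ extended cellwise; a circuit encoding of $F:Q^n\to Q^n$ is a Boolean circuit $C$ with $m_Q\circ F=C\circ m_Q$. A standard representation of a family is a language with a logarithmic-space algorithm producing a circuit encoding of a member from each word, all members represented. A block embedding of $Q_F^{V_F}$ into $Q_G^{V_G}$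 is a partition $(D_i)_{i\in V_F}$ of $V_G$ with patterns $p_{i,q}\in Q_G^{D_i}$ injective in $q$, giving $\phi(x)|_{D_i}=p_{i,x_i}$; $G$ simulates $F$ via $\phi$ with time constant $T$ if $\phi\circ F=G^T\circ\phi$. A family $(\mathcal F,\mathcal F^* )$ simulates $(\mathcal H,\mathcal H^* )$ in time $T$ and space $S$ if a logarithmic-space Turing machine maps each word representing $H:Q_H^n\to Q_H^n$ to a word representing $F\in\mathcal F$ on $S(n)$ nodes, the number $T(n)$ and a block embedding via which $F$ simulates $H$ with time constant $T(n)$. $\mathcal U_{Q,P}$ ($P$ polynomial) is the family of all $F:Q^n\to Q^n$ with a circuit encoding of size $\le P(n)$, represented by such circuits; a family is universal if for every finite $Q$ and polynomial $P$ it simulates $\mathcal U_{Q,P}$ in polynomial time and polynomial space. *)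

theory Defs
  imports Complex_Main "HOL-Library.Disjoint_Sets" "HOL-Computational_Algebra.Polynomial"
begin

subsection \<open>Automata networks\<close>

text \<open>Alphabets are \<open>{0,\<dots>,q-1}\<close> and node sets \<open>{0,\<dots>,n-1}\<close>.  A configuration is the list of
  the states of the nodes.  Maps on configurations are only ever constrained on \<open>configs q n\<close>.\<close>

type_synonym config = "nat list"
type_synonym network = "config \<Rightarrow> config"

definition configs :: "nat \<Rightarrow> nat \<Rightarrow> config set" where
  "configs q n = {x. length x = n \<and> set x \<subseteq> {..<q}}"

definition automata_network :: "nat \<Rightarrow> nat \<Rightarrow> network \<Rightarrow> bool" where
  "automata_network q n F \<longleftrightarrow> F ` configs q n \<subseteq> configs q n"

definition depends_on :: "nat \<Rightarrow> nat \<Rightarrow> network \<Rightarrow> nat \<Rightarrow> nat \<Rightarrow> bool" where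
  "depends_on q n F v u \<longleftrightarrow>
     (\<exists>x \<in> configs q n. \<exists>a<q. F (x[u := a]) ! v \<noteq> F x ! v)"

text \<open>Arcs \<open>(u, v)\<close> of the interaction graph: the state of \<open>u\<close> influences the next state of \<open>v\<close>.\<close>

definition interaction_graph :: "nat \<Rightarrow> nat \<Rightarrow> network \<Rightarrow> (nat \<times> nat) set" where
  "interaction_graph q n F = {(u, v). u < n \<and> v < n \<and> depends_on q n F v u}"


subsection \<open>Words\<close>

fun bits :: "nat \<Rightarrow> bool list" where
  "bits n = (if n = 0 then [] else odd n # bits (n div 2))"

declare bits.simps [simp del]

text \<open>Self-delimiting code: every bit is preceded by \<open>True\<close>, the end is marked by \<open>False\<close>.\<close>

definition delimit :: "bool list \<Rightarrow> bool list" where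
  "delimit w = concat (map (\<lambda>b. [True, b]) w) @ [False]"

definition word_of_nats :: "nat list \<Rightarrow> bool list" where
  "word_of_nats ns = concat (map (\<lambda>n. delimit (bits n)) ns)"

definition with_length :: "nat list \<Rightarrow> nat list" where
  "with_length ns = length ns # ns"


subsection \<open>Logarithmic-space Turing machines\<close>

text \<open>Deterministic machines with a read-only input tape (with end markers), one work tape
  and a write-only output tape.  States are \<open>{0,\<dots>,tm_states-1}\<close> with initial state \<open>0\<close>; work symbols
  are \<open>{0,\<dots>,tm_symbols-1}\<close> with blank \<open>0\<close>.  A transition yields the new state, the written
  work symbol, the moves of the input and work heads and possibly an output bit;
  the machine halts where the transition is \<open>None\<close>.\<close>

datatype head_move = MLeft | MStay | MRight
datatype input_symbol = LeftEnd | RightEnd | Sym bool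

record turing_machine =
  tm_states :: nat
  tm_symbols :: nat
  tm_delta :: "nat \<Rightarrow> input_symbol \<Rightarrow> nat \<Rightarrow>
                 (nat \<times> nat \<times> head_move \<times> head_move \<times> bool option) option"

definition wf_tm :: "turing_machine \<Rightarrow> bool" where
  "wf_tm M \<longleftrightarrow> 0 < tm_states M \<and> 0 < tm_symbols M \<and>
     (\<forall>s < tm_states M. \<forall>a. \<forall>b < tm_symbols M. \<forall>s' b' mi mw z.
        tm_delta M s a b = Some (s', b', mi, mw, z) \<longrightarrow> s' < tm_states M \<and> b' < tm_symbols M)"

record tm_config =
  cf_state :: nat
  cf_inpos :: nat
  cf_work :: "nat \<Rightarrow> nat"
  cf_workpos :: nat
  cf_output :: "bool list"

definition input_at :: "bool list \<Rightarrow> nat \<Rightarrow> input_symbol" where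
  "input_at w i =
     (if i = 0 then LeftEnd else if i \<le> length w then Sym (w ! (i - 1)) else RightEnd)"

fun move_head :: "head_move \<Rightarrow> nat \<Rightarrow> nat" where
  "move_head MLeft i = i - 1"
| "move_head MStay i = i"
| "move_head MRight i = i + 1"

definition tm_action ::
  "turing_machine \<Rightarrow> bool list \<Rightarrow> tm_config \<Rightarrow>
     (nat \<times> nat \<times> head_move \<times> head_move \<times> bool option) option" where
  "tm_action M w c =
     tm_delta M (cf_state c) (input_at w (cf_inpos c)) (cf_work c (cf_workpos c))"

definition tm_step :: "turing_machine \<Rightarrow> bool list \<Rightarrow> tm_config \<Rightarrow> tm_config" where
  "tm_step M w c =
     (case tm_action M w c of
        None \<Rightarrow> c
      | Some (s, b, mi, mw, z) \<Rightarrow>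
          \<lparr> cf_state = s,
            cf_inpos = min (move_head mi (cf_inpos c)) (length w + 1),
            cf_work = (cf_work c)(cf_workpos c := b),
            cf_workpos = move_head mw (cf_workpos c),
            cf_output = cf_output c @ (case z of None \<Rightarrow> [] | Some d \<Rightarrow> [d]) \<rparr>)"

definition tm_init :: tm_config where
  "tm_init = \<lparr> cf_state = 0, cf_inpos = 0, cf_work = (\<lambda>_. 0), cf_workpos = 0, cf_output = [] \<rparr>"

definition tm_run :: "turing_machine \<Rightarrow> bool list \<Rightarrow> nat \<Rightarrow> tm_config" where
  "tm_run M w t = (tm_step M w ^^ t) tm_init"

definition tm_computes :: "turing_machine \<Rightarrow> (bool list \<Rightarrow> bool list) \<Rightarrow> bool" where
  "tm_computes M f \<longleftrightarrow>
     (\<forall>w. \<exists>t. tm_action M w (tm_run M w t) = None \<and> cf_output (tm_run M w t) = f w)"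

definition tm_logspace :: "turing_machine \<Rightarrow> bool" where
  "tm_logspace M \<longleftrightarrow>
     (\<exists>c::real. \<forall>w t. real (cf_workpos (tm_run M w t)) \<le> c * (1 + log 2 (real (length w + 1))))"

definition logspace_computable :: "(bool list \<Rightarrow> bool list) \<Rightarrow> bool" where
  "logspace_computable f \<longleftrightarrow> (\<exists>M. wf_tm M \<and> tm_logspace M \<and> tm_computes M f)"


subsection \<open>Boolean circuits\<close>

text \<open>Wires \<open>0,\<dots>,c_inputs-1\<close> carry the inputs and wire \<open>c_inputs + i\<close> the result of the
  \<open>i\<close>-th gate, which may only read wires of smaller number.\<close>

datatype bgate = NotGate nat | AndGate nat nat | OrGate nat nat

record circuit =
  c_inputs :: nat
  c_gates :: "bgate list"
  c_outputs :: "nat list"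

fun bgate_args :: "bgate \<Rightarrow> nat set" where
  "bgate_args (NotGate a) = {a}"
| "bgate_args (AndGate a b) = {a, b}"
| "bgate_args (OrGate a b) = {a, b}"

definition wf_circuit :: "circuit \<Rightarrow> bool" where
  "wf_circuit C \<longleftrightarrow>
     (\<forall>i < length (c_gates C). bgate_args (c_gates C ! i) \<subseteq> {..<c_inputs C + i}) \<and>
     set (c_outputs C) \<subseteq> {..<c_inputs C + length (c_gates C)}"

definition circuit_size :: "circuit \<Rightarrow> nat" where
  "circuit_size C = length (c_gates C)"

fun bgate_eval :: "bool list \<Rightarrow> bgate \<Rightarrow> bool" where
  "bgate_eval ws (NotGate a) = (\<not> ws ! a)"
| "bgate_eval ws (AndGate a b) = (ws ! a \<and> ws ! b)"
| "bgate_eval ws (OrGate a b) = (ws ! a \<or> ws ! b)"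

definition circuit_eval :: "circuit \<Rightarrow> bool list \<Rightarrow> bool list" where
  "circuit_eval C inp =
     map ((!) (foldl (\<lambda>ws g. ws @ [bgate_eval ws g]) inp (c_gates C))) (c_outputs C)"

fun bgate_nats :: "bgate \<Rightarrow> nat list" where
  "bgate_nats (NotGate a) = [0, a]"
| "bgate_nats (AndGate a b) = [1, a, b]"
| "bgate_nats (OrGate a b) = [2, a, b]"

definition circuit_word :: "circuit \<Rightarrow> bool list" where
  "circuit_word C =
     word_of_nats ([c_inputs C, length (c_gates C)] @ concat (map bgate_nats (c_gates C)) @
       with_length (c_outputs C))"

text \<open>\<open>m q\<close> is the fixed injection of the alphabet of size \<open>q\<close> into the binary words of length \<open>k q\<close>.
  Positivity of \<open>k q\<close> only matters for one-letter alphabets, where otherwise a circuit would not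
  determine the number of nodes.\<close>

definition alphabet_code :: "(nat \<Rightarrow> nat) \<Rightarrow> (nat \<Rightarrow> nat \<Rightarrow> bool list) \<Rightarrow> bool" where
  "alphabet_code k m \<longleftrightarrow>
     (\<forall>q. 0 < k q \<and> inj_on (m q) {..<q} \<and> (\<forall>a<q. length (m q a) = k q))"

definition encode_config :: "(nat \<Rightarrow> nat \<Rightarrow> bool list) \<Rightarrow> nat \<Rightarrow> config \<Rightarrow> bool list" where
  "encode_config m q x = concat (map (m q) x)"

definition circuit_encoding ::
  "(nat \<Rightarrow> nat) \<Rightarrow> (nat \<Rightarrow> nat \<Rightarrow> bool list) \<Rightarrow> nat \<Rightarrow> nat \<Rightarrow> network \<Rightarrow> circuit \<Rightarrow> bool" where
  "circuit_encoding k m q n F C \<longleftrightarrow>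
     wf_circuit C \<and> c_inputs C = n * k q \<and> length (c_outputs C) = n * k q \<and>
     (\<forall>x \<in> configs q n. encode_config m q (F x) = circuit_eval C (encode_config m q x))"


subsection \<open>Represented families, simulation and universality\<close>

text \<open>\<open>fam_member \<F> n F\<close>: \<open>F\<close> is a network of the family on \<open>n\<close> nodes.
  \<open>fam_repr \<F> w n F\<close>: the word \<open>w\<close> represents the network \<open>F\<close> on \<open>n\<close> nodes.\<close>

record family =
  fam_alphabet :: nat
  fam_member :: "nat \<Rightarrow> network \<Rightarrow> bool"
  fam_repr :: "bool list \<Rightarrow> nat \<Rightarrow> network \<Rightarrow> bool"

text \<open>Simulation and universality are meant for families with a standard representation; this is not
  a hypothesis of the definitions below, so that failing to be universal cannot be due to it.\<close>

definition standard_representation ::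
  "(nat \<Rightarrow> nat) \<Rightarrow> (nat \<Rightarrow> nat \<Rightarrow> bool list) \<Rightarrow> family \<Rightarrow> bool" where
  "standard_representation k m \<F> \<longleftrightarrow>
     (\<exists>f. logspace_computable f \<and>
       (\<forall>w n F. fam_member \<F> n F \<and> fam_repr \<F> w n F \<longrightarrow>
         (\<exists>C. f w = circuit_word C \<and> circuit_encoding k m (fam_alphabet \<F>) n F C))) \<and>
     (\<forall>n F. fam_member \<F> n F \<longrightarrow> (\<exists>w. fam_repr \<F> w n F))"

text \<open>\<open>U_family k m q P\<close> is the family \<open>U\<^bsub>Q,P\<^esub>\<close>.\<close>

definition U_family ::
  "(nat \<Rightarrow> nat) \<Rightarrow> (nat \<Rightarrow> nat \<Rightarrow> bool list) \<Rightarrow> nat \<Rightarrow> nat poly \<Rightarrow> family" where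
  "U_family k m q P =
     \<lparr> fam_alphabet = q,
       fam_member = (\<lambda>n F. automata_network q n F \<and>
         (\<exists>C. circuit_encoding k m q n F C \<and> circuit_size C \<le> poly P n)),
       fam_repr = (\<lambda>w n F. \<exists>C. w = circuit_word C \<and>
         circuit_encoding k m q n F C \<and> circuit_size C \<le> poly P n) \<rparr>"

text \<open>Blocks \<open>D i\<close> (for \<open>i < n\<close>) partition the nodes \<open>{0,\<dots>,N-1}\<close>; \<open>p i a\<close> is the pattern on \<open>D i\<close>
  coding state \<open>a\<close> of node \<open>i\<close> (only its values on \<open>D i\<close> matter).\<close>

definition block_embedding ::
  "nat \<Rightarrow> nat \<Rightarrow> nat \<Rightarrow> nat \<Rightarrow> (nat \<Rightarrow> nat set) \<Rightarrow> (nat \<Rightarrow> nat \<Rightarrow> nat \<Rightarrow> nat) \<Rightarrow> bool" where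
  "block_embedding qF n qG N D p \<longleftrightarrow>
     disjoint_family_on D {..<n} \<and> (\<Union>i<n. D i) = {..<N} \<and> (\<forall>i<n. D i \<noteq> {}) \<and>
     (\<forall>i<n. \<forall>a<qF. \<forall>v \<in> D i. p i a v < qG) \<and>
     (\<forall>i<n. inj_on (\<lambda>a. restrict (p i a) (D i)) {..<qF})"

definition embed ::
  "nat \<Rightarrow> nat \<Rightarrow> (nat \<Rightarrow> nat set) \<Rightarrow> (nat \<Rightarrow> nat \<Rightarrow> nat \<Rightarrow> nat) \<Rightarrow> config \<Rightarrow> config" where
  "embed n N D p x =
     map (\<lambda>v. let i = (THE i. i < n \<and> v \<in> D i) in p i (x ! i) v) [0..<N]"

definition simulates_via ::
  "nat \<Rightarrow> nat \<Rightarrow> network \<Rightarrow> network \<Rightarrow> (config \<Rightarrow> config) \<Rightarrow> nat \<Rightarrow> bool" where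
  "simulates_via qF n G F \<phi> T \<longleftrightarrow> (\<forall>x \<in> configs qF n. \<phi> (F x) = (G ^^ T) (\<phi> x))"

definition block_embedding_word ::
  "nat \<Rightarrow> nat \<Rightarrow> (nat \<Rightarrow> nat set) \<Rightarrow> (nat \<Rightarrow> nat \<Rightarrow> nat \<Rightarrow> nat) \<Rightarrow> bool list" where
  "block_embedding_word qF n D p =
     word_of_nats (n # concat (map (\<lambda>i.
       with_length (sorted_list_of_set (D i)) @
       concat (map (\<lambda>a. map (p i a) (sorted_list_of_set (D i))) [0..<qF])) [0..<n]))"

definition simulates :: "family \<Rightarrow> family \<Rightarrow> (nat \<Rightarrow> nat) \<Rightarrow> (nat \<Rightarrow> nat) \<Rightarrow> bool" where
  "simulates \<F> \<H> T S \<longleftrightarrow>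
     (\<exists>f. logspace_computable f \<and>
       (\<forall>w n H. fam_member \<H> n H \<and> fam_repr \<H> w n H \<longrightarrow>
         (\<exists>w' F D p.
            fam_member \<F> (S n) F \<and> fam_repr \<F> w' (S n) F \<and>
            block_embedding (fam_alphabet \<H>) n (fam_alphabet \<F>) (S n) D p \<and>
            simulates_via (fam_alphabet \<H>) n F H (embed n (S n) D p) (T n) \<and>
            f w = delimit w' @ delimit (bits (T n)) @
                  block_embedding_word (fam_alphabet \<H>) n D p)))"

definition polynomially_bounded :: "(nat \<Rightarrow> nat) \<Rightarrow> bool" where
  "polynomially_bounded f \<longleftrightarrow> (\<exists>P :: nat poly. \<forall>n. f n \<le> poly P n)"

definition universal :: "(nat \<Rightarrow> nat) \<Rightarrow> (nat \<Rightarrow> nat \<Rightarrow> bool list) \<Rightarrow> family \<Rightarrow> bool" where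
  "universal k m \<F> \<longleftrightarrow>
     (\<forall>q>0. \<forall>P :: nat poly. \<exists>T S. polynomially_bounded T \<and> polynomially_bounded S \<and>
        simulates \<F> (U_family k m q P) T S)"


subsection \<open>Networks built from a set of gates\<close>

record gate =
  g_in :: nat
  g_out :: nat
  g_map :: "nat list \<Rightarrow> nat list"

definition gate_inputs :: "gate list \<Rightarrow> (nat \<times> nat) set" where
  "gate_inputs gs = {(j, l). j < length gs \<and> l < g_in (gs ! j)}"

definition gate_outputs :: "gate list \<Rightarrow> (nat \<times> nat) set" where
  "gate_outputs gs = {(j, l). j < length gs \<and> l < g_out (gs ! j)}"

definition gate_network :: "nat \<Rightarrow> gate set \<Rightarrow> nat \<Rightarrow> network \<Rightarrow> bool" where
  "gate_network q \<G> n F \<longleftrightarrow> automata_network q n F \<and>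
     (\<exists>gs \<alpha> \<beta>. set gs \<subseteq> \<G> \<and>
        bij_betw \<alpha> (gate_inputs gs) {..<n} \<and> bij_betw \<beta> {..<n} (gate_outputs gs) \<and>
        \<not> (\<exists>j l l'. (j, l) \<in> gate_inputs gs \<and> \<beta> (\<alpha> (j, l)) = (j, l')) \<and>
        (\<forall>x \<in> configs q n. \<forall>v<n. \<forall>j l. \<beta> v = (j, l) \<longrightarrow>
           F x ! v = g_map (gs ! j) (map (\<lambda>i. x ! \<alpha> (j, i)) [0..<g_in (gs ! j)]) ! l))"

text \<open>Interaction graph plus local transition tables: for each node \<open>v\<close>, the list of its
  in-neighbours and the values of its local map on all tuples of states of these, in
  lexicographic order.  For networks over a finite gate set the degrees are bounded, since
  every node feeds exactly one gate and is fed by exactly one gate.\<close>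

definition tuple_index :: "nat \<Rightarrow> nat list \<Rightarrow> nat" where
  "tuple_index q xs = foldl (\<lambda>r a. q * r + a) 0 xs"

definition table_description ::
  "nat \<Rightarrow> nat \<Rightarrow> network \<Rightarrow> (nat list \<times> nat list) list \<Rightarrow> bool" where
  "table_description q n F ds \<longleftrightarrow> length ds = n \<and>
     (\<forall>v<n. \<forall>us tb. ds ! v = (us, tb) \<longrightarrow>
        distinct us \<and> set us = {u. (u, v) \<in> interaction_graph q n F} \<and>
        length tb = q ^ length us \<and>
        (\<forall>x \<in> configs q n. F x ! v = tb ! tuple_index q (map ((!) x) us)))"

definition table_word :: "(nat list \<times> nat list) list \<Rightarrow> bool list" where
  "table_word ds =
     word_of_nats (length ds # concat (map (\<lambda>(us, tb). with_length us @ with_length tb) ds))"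

definition gate_network_family :: "nat \<Rightarrow> gate set \<Rightarrow> family" where
  "gate_network_family q \<G> =
     \<lparr> fam_alphabet = q,
       fam_member = gate_network q \<G>,
       fam_repr = (\<lambda>w n F. \<exists>ds. table_description q n F ds \<and> w = table_word ds) \<rparr>"


subsection \<open>The gate set \<open>\<G>\<^sub>t\<close>\<close>

definition and01 :: "nat \<Rightarrow> nat \<Rightarrow> nat" where
  "and01 x y = (if 2 \<in> {x, y} then 2 else if x = 1 \<and> y = 1 then 1 else 0)"

definition and2 :: "nat \<Rightarrow> nat \<Rightarrow> nat" where
  "and2 x y = (if 2 \<in> {x, y} \<or> (x = 1 \<and> y = 1) then 2 else 0)"

definition lambda_map :: "nat \<Rightarrow> nat \<Rightarrow> nat" where
  "lambda_map x y = (if 2 \<in> {x, y} then 2 else x)"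

definition G_t :: "gate set" where
  "G_t =
     {\<lparr> g_in = 2, g_out = 1, g_map = (\<lambda>xs. [and01 (xs ! 0) (xs ! 1)]) \<rparr>,
      \<lparr> g_in = 2, g_out = 1, g_map = (\<lambda>xs. [and2 (xs ! 0) (xs ! 1)]) \<rparr>,
      \<lparr> g_in = 2, g_out = 1, g_map = (\<lambda>xs. [lambda_map (xs ! 0) (xs ! 1)]) \<rparr>,
      \<lparr> g_in = 1, g_out = 1, g_map = (\<lambda>xs. [xs ! 0]) \<rparr>,
      \<lparr> g_in = 1, g_out = 2, g_map = (\<lambda>xs. [xs ! 0, xs ! 0]) \<rparr>}"

end

theory Submission imports Defs "HOL-Real_Asymp.Real_Asymp" "HOL-Computational_Algebra.Primes" begin

text \<open>
  In a \<open>\<G>\<^sub>t\<close>-network the state 2 spreads along all arcs. On a periodic orbit, a node lying on a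
  cycle of length \<open>c\<close> therefore shows 2 at a \<open>c\<close>-periodic set of times. Between the 2s, the state 0
  spreads in the same way along the arcs whose 0/1 value matters, so nodes on cycles of such arcs
  are \<open>c\<close>-periodic altogether. All other nodes are functions of earlier ones. Hence every period of
  a network on \<open>N\<close> nodes divides the least common multiple of the numbers up to \<open>N\<^sup>2\<close>,
  which is not divisible by a power of two exceeding \<open>N\<^sup>2\<close>. Binary counters on \<open>n\<close> bits have
  linear-size circuits and period \<open>2\<^sup>n\<close>, so simulating them requires \<open>2\<^sup>n \<le> N\<^sup>2\<close>.
\<close>

section \<open>Periodic orbits\<close>

text \<open>\<open>a t v\<close> is the state of node \<open>v\<close> at time \<open>t\<close>.
  Arcs are defined by the behaviour along this one orbit, not by the wiring.\<close>

definition preserving_arcs :: "nat \<Rightarrow> (nat \<Rightarrow> nat \<Rightarrow> 'a) \<Rightarrow> 'a set \<Rightarrow> (nat \<times> nat) set" where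
  "preserving_arcs N a A =
     {(u, v). u < N \<and> v < N \<and> (\<forall>t. a t u \<in> A \<longrightarrow> a (Suc t) v \<in> A)}"

lemma preserving_arcs_subset: "preserving_arcs N a A \<subseteq> {..<N} \<times> {..<N}"
  by (auto simp: preserving_arcs_def)

lemma finite_preserving_arcs [simp]: "finite (preserving_arcs N a A)"
  by (rule finite_subset[OF preserving_arcs_subset]) simp

lemma card_preserving_arcs_le: "card (preserving_arcs N a A) \<le> N * N"
  using card_mono[OF _ preserving_arcs_subset[of N a A]] by simp

lemma preserving_arcs_relpow:
  assumes "(u, v) \<in> preserving_arcs N a A ^^ d" "a t u \<in> A"
  shows "a (t + d) v \<in> A"
  using assms
proof (induction d arbitrary: v)
  case (Suc d)
  then obtain w where "(u, w) \<in> preserving_arcs N a A ^^ d" "(w, v) \<in> preserving_arcs N a A"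
    by auto
  with Suc show ?case by (auto simp: preserving_arcs_def)
qed simp

lemma periodic_mult:
  fixes M :: nat
  assumes "\<And>t. a (t + M) = a t"
  shows "a (t + M * j) = a t"
proof (induction j)
  case (Suc j)
  have "a (t + M * Suc j) = a (t + M * j + M)" by (simp add: ac_simps)
  then show ?case using Suc assms by simp
qed simp

text \<open>Membership in \<open>A\<close> is carried around a closed walk of length
  \<open>c\<close>; the global period \<open>M\<close> reverses this implication. The walk can be
  chosen no longer than the number of arcs, whence the bound \<open>N * N\<close>.\<close>

lemma periodic_on_cycle:
  assumes per: "\<And>t. a (t + M) = a t" and "M > 0"
    and L: "\<And>c. 0 < c \<Longrightarrow> c \<le> N * N \<Longrightarrow> c dvd L"
    and cyc: "(v, v) \<in> (preserving_arcs N a A)\<^sup>+"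
  shows "a (t + L) v \<in> A \<longleftrightarrow> a t v \<in> A"
proof -
  obtain c where c: "0 < c" "c \<le> card (preserving_arcs N a A)"
    "(v, v) \<in> preserving_arcs N a A ^^ c"
    using cyc by (auto simp: trancl_finite_eq_relpow)
  have mult: "a (t + c * j) v \<in> A" if "a t v \<in> A" for t j
    using that
  proof (induction j)
    case (Suc j)
    then have "a (t + c * j + c) v \<in> A" by (intro preserving_arcs_relpow[OF c(3)]) simp
    then show ?case by (simp add: ac_simps)
  qed simp
  have "c dvd L" using c card_preserving_arcs_le[of N a A] by (intro L) auto
  then obtain j where j: "L = c * j" by blast
  show ?thesis
  proof
    assume "a t v \<in> A"
    then show "a (t + L) v \<in> A" using mult j by simp
  next
    assume "a (t + L) v \<in> A"
    \<comment> \<open>Since \<open>L = c * j\<close>, another \<open>j * (M - 1)\<close> rounds lead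
      from time \<open>t + L\<close> to \<open>t + M * L\<close>, where the orbit is as at time
      \<open>t\<close>.\<close>
    then have "a (t + L + c * (j * (M - 1))) v \<in> A" by (rule mult)
    moreover have "t + L + c * (j * (M - 1)) = t + M * L"
      using \<open>M > 0\<close> j by (cases M) (auto simp: algebra_simps)
    ultimately have "a (t + M * L) v \<in> A" by (simp only:)
    then show "a t v \<in> A" using periodic_mult[of a M, OF per] by simp
  qed
qed

locale periodic_orbit =
  fixes N M L :: nat and a :: "nat \<Rightarrow> nat \<Rightarrow> nat"
  assumes per: "\<And>t. a (t + M) = a t" and M_pos: "M > 0"
    and L: "\<And>c. 0 < c \<Longrightarrow> c \<le> N * N \<Longrightarrow> c dvd L"
    and states: "\<And>t v. v < N \<Longrightarrow> a t v < 3"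
    and gates: "\<And>v. v < N \<Longrightarrow> \<exists>u<N. \<exists>w<N. \<exists>g \<in> {and01, and2, lambda_map}.
                  \<forall>t. a (Suc t) v = g (a t u) (a t w)"
begin

definition arcs :: "(nat \<times> nat) set" where
  "arcs = preserving_arcs N a {2}"

text \<open>Along these arcs 0 spreads as well, except where it is overwritten by 2. They include both
  inputs of an \<open>and01\<close> gate, only the first one of a \<open>lambda_map\<close> gate and in general none of an
  \<open>and2\<close> gate; an \<open>and2\<close> gate never outputs 1, so it is known once its occurrences of 2 are.\<close>

definition strong_arcs :: "(nat \<times> nat) set" where
  "strong_arcs = arcs \<inter> preserving_arcs N a {0, 2}"

text \<open>All three gates output 2 as soon as one input is 2, so both input nodes of
  \<open>v\<close> send it an arc.\<close>

lemma determined_by_arcs: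
  assumes "v < N" "\<And>u. (u, v) \<in> arcs \<Longrightarrow> a s u = a t u"
  shows "a (Suc s) v = a (Suc t) v"
proof -
  obtain u w g where g: "u < N" "w < N" "g \<in> {and01, and2, lambda_map}"
    "\<And>t. a (Suc t) v = g (a t u) (a t w)"
    using gates[OF assms(1)] by metis
  have "(u, v) \<in> arcs" "(w, v) \<in> arcs"
    using g assms(1)
    by (auto simp: arcs_def preserving_arcs_def and01_def and2_def lambda_map_def)
  then show ?thesis using assms(2) g(4) by simp
qed

lemma determined_by_strong_arcs:
  assumes "v < N" "\<And>u. (u, v) \<in> strong_arcs \<Longrightarrow> a s u = a t u"
    and two: "a (Suc s) v = 2 \<longleftrightarrow> a (Suc t) v = 2"
  shows "a (Suc s) v = a (Suc t) v"
proof -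
  obtain u w g where g: "u < N" "w < N" "g \<in> {and01, and2, lambda_map}"
    "\<And>t. a (Suc t) v = g (a t u) (a t w)"
    using gates[OF assms(1)] by metis
  consider "g = and01" | "g = and2" | "g = lambda_map" using g(3) by blast
  then show ?thesis
  proof cases
    case 1
    then have "(u, v) \<in> strong_arcs" "(w, v) \<in> strong_arcs"
      using g assms(1)
      by (auto simp: strong_arcs_def arcs_def preserving_arcs_def and01_def)
    then show ?thesis using assms(2) g(4) by simp
  next
    case 2
    then show ?thesis using two g(4) by (auto simp: and2_def split: if_splits)
  next
    case 3
    then have "(u, v) \<in> strong_arcs"
      using g assms(1)
      by (auto simp: strong_arcs_def arcs_def preserving_arcs_def lambda_map_def)
    then have "a s u = a t u" by (rule assms(2))
    \<comment> \<open>The second input matters only by being 2, which \<open>two\<close> accounts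
      for; otherwise the output copies the first input.\<close>
    then show ?thesis using two g(4) 3 by (auto simp: lambda_map_def split: if_splits)
  qed
qed

text \<open>Gate equations speak of successor times only; going once around the period
  \<open>M\<close> turns every time into a successor.\<close>

lemma periodic_from_Suc:
  assumes "\<And>t. a (Suc (t + L)) v = a (Suc t) v"
  shows "a (t + L) v = a t v"
proof -
  have "a (t + L) v = a (t + L + M) v" by (simp add: per)
  also have "t + L + M = Suc (t + (M - 1) + L)" using M_pos by simp
  also have "a \<dots> v = a (Suc (t + (M - 1))) v" by (rule assms)
  also have "\<dots> = a (t + M) v" using M_pos by simp
  finally show ?thesis by (simp add: per)
qed

text \<open>Pairs along which periodicity is passed on. A node off the cycles of \<open>arcs\<close>
  needs all its incoming arcs; one on such a cycle but on no strong cycle needs only the strong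
  ones, its 2s being settled by the cycle; one on a strong cycle needs none.\<close>

definition influence :: "(nat \<times> nat) set" where
  "influence = {(u, v) \<in> arcs. (v, v) \<notin> arcs\<^sup>+} \<union> {(u, v) \<in> strong_arcs. (v, v) \<notin> strong_arcs\<^sup>+}"

text \<open>Every node of a cycle of \<open>influence\<close> lies on a cycle of
  \<open>arcs\<close>, so the arcs entering it along the cycle are strong. The cycle is then a
  strong one, and no arc of \<open>influence\<close> enters a node on a strong cycle.\<close>

lemma wf_influence: "wf influence"
proof (rule finite_acyclic_wf)
  have sub: "influence \<subseteq> arcs" by (auto simp: influence_def strong_arcs_def)
  then show "finite influence" by (rule finite_subset) (simp add: arcs_def)
  show "acyclic influence"
  proof (rule acyclicI, intro allI notI)
    fix v assume v: "(v, v) \<in> influence\<^sup>+"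
    \<comment> \<open>The return path from \<open>w\<close> to \<open>v\<close> is carried through
      the induction, so that every node passed is seen to lie on a cycle.\<close>
    have "(v, w) \<in> strong_arcs\<^sup>+" if "(v, w) \<in> influence\<^sup>+" "(w, v) \<in> influence\<^sup>*" for w
      using that
    proof (induction rule: trancl_induct)
      case (base w)
      have "(w, w) \<in> influence\<^sup>+" using base by simp
      then have "(w, w) \<in> arcs\<^sup>+" using sub by (meson trancl_mono subsetD)
      then show ?case using base by (auto simp: influence_def)
    next
      case (step x w)
      have "(w, w) \<in> influence\<^sup>+" using step
        by (meson rtrancl_into_trancl1 rtrancl_trans trancl_into_rtrancl)
      then have "(w, w) \<in> arcs\<^sup>+" using sub by (meson trancl_mono subsetD)
      then have "(x, w) \<in> strong_arcs" using step(2) by (auto simp: influence_def)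
      moreover have "(v, x) \<in> strong_arcs\<^sup>+"
        using step by (meson converse_rtrancl_into_rtrancl)
      ultimately show ?case by simp
    qed
    then have "(v, v) \<in> strong_arcs\<^sup>+" using v by simp
    moreover have "(v, v) \<in> arcs\<^sup>+" using v sub by (meson trancl_mono subsetD)
    moreover obtain u where "(u, v) \<in> influence" using v by (meson tranclE)
    ultimately show False by (auto simp: influence_def)
  qed
qed

lemma orbit_period:
  assumes "v < N"
  shows "a (t + L) v = a t v"
  using wf_influence assms
proof (induction v arbitrary: t rule: wf_induct_rule)
  case (less v)
  have IH: "a (t + L) u = a t u" if "(u, v) \<in> influence" for u t
    using that by (intro less.IH) (auto simp: influence_def strong_arcs_def arcs_def preserving_arcs_def)
  show ?case
  proof (cases "(v, v) \<in> arcs\<^sup>+")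
    case False
    show ?thesis
    proof (rule periodic_from_Suc, rule determined_by_arcs[OF less.prems])
      fix t u assume "(u, v) \<in> arcs"
      then show "a (t + L) u = a t u" using False by (intro IH) (simp add: influence_def)
    qed
  next
    case True
    then have two: "a (t + L) v = 2 \<longleftrightarrow> a t v = 2" for t
      using periodic_on_cycle[of a M N L v "{2}" t, OF per M_pos L] by (simp add: arcs_def)
    show ?thesis
    proof (cases "(v, v) \<in> strong_arcs\<^sup>+")
      case False
      show ?thesis
      proof (rule periodic_from_Suc, rule determined_by_strong_arcs[OF less.prems])
        fix t u assume "(u, v) \<in> strong_arcs"
        then show "a (t + L) u = a t u" using False by (intro IH) (simp add: influence_def)
      next
        fix t show "a (Suc (t + L)) v = 2 \<longleftrightarrow> a (Suc t) v = 2" using two[of "Suc t"] by simp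
      qed
    next
      case True
      then have "(v, v) \<in> (preserving_arcs N a {0, 2})\<^sup>+"
        by (rule trancl_mono) (auto simp: strong_arcs_def)
      then have "a (t + L) v \<in> {0, 2} \<longleftrightarrow> a t v \<in> {0, 2}"
        by (intro periodic_on_cycle[of a M N L v "{0, 2}" t, OF per M_pos L])
      \<comment> \<open>A state below 3 is known once its membership in \<open>{2}\<close> and in
        \<open>{0, 2}\<close> is.\<close>
      with two[of t] states[OF less.prems, of t] states[OF less.prems, of "t + L"]
      show ?thesis by auto
    qed
  qed
qed

end

section \<open>Periods of \<open>G_t\<close>-networks\<close>

text \<open>\<open>\<beta> v\<close> is the gate output feeding \<open>v\<close>, and
  \<open>\<alpha>\<close> gives the nodes that this gate reads; the local maps thus take the shape
  required by \<open>periodic_orbit\<close>.\<close>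

lemma G_t_network_gates:
  assumes "gate_network 3 G_t N F" "v < N"
  shows "\<exists>u<N. \<exists>w<N. \<exists>g \<in> {and01, and2, lambda_map}.
           \<forall>x \<in> configs 3 N. F x ! v = g (x ! u) (x ! w)"
proof -
  from assms(1) obtain gs \<alpha> \<beta> where gs: "set gs \<subseteq> G_t"
    and \<alpha>: "bij_betw \<alpha> (gate_inputs gs) {..<N}" and \<beta>: "bij_betw \<beta> {..<N} (gate_outputs gs)"
    and F: "\<And>x v j l. x \<in> configs 3 N \<Longrightarrow> v < N \<Longrightarrow> \<beta> v = (j, l) \<Longrightarrow>
           F x ! v = g_map (gs ! j) (map (\<lambda>i. x ! \<alpha> (j, i)) [0..<g_in (gs ! j)]) ! l"
    unfolding gate_network_def by blast
  obtain j l where jl: "\<beta> v = (j, l)" by fastforce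
  have "(j, l) \<in> gate_outputs gs" using bij_betwE[OF \<beta>] assms(2) jl by (metis lessThan_iff)
  then have j: "j < length gs" and l: "l < g_out (gs ! j)" by (auto simp: gate_outputs_def)
  have \<alpha>_less: "\<alpha> (j, i) < N" if "i < g_in (gs ! j)" for i
    using bij_betwE[OF \<alpha>] that j by (auto simp: gate_inputs_def)
  have gate: "gs ! j \<in> G_t" using gs j by (meson nth_mem subsetD)
  have id: "and01 b b = b" if "b < 3" for b using that by (auto simp: and01_def)
  have val: "x ! u < 3" if "x \<in> configs 3 N" "u < N" for x u
    using that by (auto simp: configs_def subset_iff)
  consider (binary) g where "g \<in> {and01, and2, lambda_map}" "g_in (gs ! j) = 2" "l = 0"
      "g_map (gs ! j) = (\<lambda>xs. [g (xs ! 0) (xs ! 1)])"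
    | (unary) "g_in (gs ! j) = 1" "\<And>xs. g_map (gs ! j) xs ! l = xs ! 0"
    using gate l unfolding G_t_def by (fastforce simp: less_2_cases_iff)
  then show ?thesis
  proof cases
    case binary
    then have "F x ! v = g (x ! \<alpha> (j, 0)) (x ! \<alpha> (j, 1))" if "x \<in> configs 3 N" for x
      using F[OF that assms(2) jl] by simp
    then show ?thesis using binary \<alpha>_less[of 0] \<alpha>_less[of 1] by fastforce
  next
    case unary
    then have "F x ! v = x ! \<alpha> (j, 0)" if "x \<in> configs 3 N" for x
      using F[OF that assms(2) jl] by simp
    \<comment> \<open>\<open>Id\<close> and \<open>\<Upsilon>\<close> are the diagonal of \<open>and01\<close>.\<close>
    then have "\<forall>x \<in> configs 3 N. F x ! v = and01 (x ! \<alpha> (j, 0)) (x ! \<alpha> (j, 0))"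
      using id val \<alpha>_less[of 0] unary by simp
    then show ?thesis using unary(1) \<alpha>_less[of 0] by (metis insertI1 zero_less_one)
  qed
qed

lemma funpow_configs:
  assumes "automata_network q n F" "x \<in> configs q n"
  shows "(F ^^ t) x \<in> configs q n"
  using assms by (induction t) (auto simp: automata_network_def)

lemma G_t_network_period:
  assumes F: "gate_network 3 G_t N F" and y: "y \<in> configs 3 N"
    and M: "(F ^^ M) y = y" "M > 0"
    and L: "\<And>c. 0 < c \<Longrightarrow> c \<le> N * N \<Longrightarrow> c dvd L"
  shows "(F ^^ L) y = y"
proof -
  have conf: "(F ^^ t) y \<in> configs 3 N" for t
    using F y by (intro funpow_configs) (auto simp: gate_network_def)
  interpret periodic_orbit N M L "\<lambda>t v. (F ^^ t) y ! v"
  proof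
    \<comment> \<open>Equality is required at all indices, also beyond \<open>N\<close>; it holds
      because the configurations themselves coincide.\<close>
    show "(\<lambda>v. (F ^^ (t + M)) y ! v) = (\<lambda>v. (F ^^ t) y ! v)" for t
      using M by (simp add: funpow_add)
    show "(F ^^ t) y ! v < 3" if "v < N" for t v
      using conf[of t] that by (auto simp: configs_def subset_iff)
    show "\<exists>u<N. \<exists>w<N. \<exists>g \<in> {and01, and2, lambda_map}.
        \<forall>t. (F ^^ Suc t) y ! v = g ((F ^^ t) y ! u) ((F ^^ t) y ! w)" if "v < N" for v
      using G_t_network_gates[OF F that] conf by (metis comp_apply funpow.simps(2))
  qed (use M L in auto)
  show ?thesis
  proof (rule nth_equalityI)
    show "length ((F ^^ L) y) = length y" using conf[of L] y by (simp add: configs_def)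
    fix v assume "v < length ((F ^^ L) y)"
    then have "v < N" using conf[of L] by (simp add: configs_def)
    then show "(F ^^ L) y ! v = y ! v" using orbit_period[of v 0] by simp
  qed
qed

text \<open>Multiplicities of the prime 2 combine by maximum in a least common multiple.
  \<open>Lcm {}\<close> is 1, so the empty set is excluded by \<open>n > 0\<close>.\<close>

lemma two_power_dvd_Lcm:
  assumes "finite A" "0 \<notin> A" "(2::nat) ^ n dvd Lcm A" "n > 0"
  shows "\<exists>c \<in> A. 2 ^ n dvd c"
  using assms
proof (induction A rule: finite_induct)
  case (insert c A)
  have "Lcm A \<noteq> 0" "c \<noteq> 0" using insert by (auto simp: Lcm_0_iff)
  moreover have "prime (2::nat)" by simp
  ultimately have "multiplicity 2 (lcm c (Lcm A)) = max (multiplicity 2 c) (multiplicity 2 (Lcm A))"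
    by (intro multiplicity_lcm) auto
  then have "2 ^ n dvd c \<or> 2 ^ n dvd Lcm A"
    using insert.prems \<open>Lcm A \<noteq> 0\<close> \<open>c \<noteq> 0\<close>
    by (auto simp: power_dvd_iff_le_multiplicity max_def split: if_splits)
  then show ?case using insert by auto
qed auto

section \<open>The binary counter\<close>

text \<open>The least significant bit comes first, and a carry out of the last cell is
  dropped.\<close>

fun increment :: network where
  "increment [] = []"
| "increment (b # x) = (if b = 1 then 0 # increment x else 1 # x)"

fun counter_value :: "config \<Rightarrow> nat" where
  "counter_value [] = 0"
| "counter_value (b # x) = b + 2 * counter_value x"

lemma length_increment [simp]: "length (increment x) = length x"
  by (induction x) auto

lemma automata_network_increment: "automata_network 2 n increment"
proof -
  have "set x \<subseteq> {..<2} \<Longrightarrow> set (increment x) \<subseteq> {..<2}" for x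
    by (induction x) auto
  then show ?thesis by (auto simp: automata_network_def configs_def)
qed

text \<open>A carry reaches cell \<open>i\<close> when all lower bits are 1. This non-recursive form
  is what the circuit computes.\<close>

lemma nth_increment:
  assumes "set x \<subseteq> {..<2}" "i < length x"
  shows "increment x ! i = (if \<forall>j<i. x ! j = 1 then 1 - x ! i else x ! i)"
  using assms
proof (induction x arbitrary: i)
  case (Cons b x)
  then show ?case by (cases i) (auto simp: All_less_Suc2 less_2_cases_iff nth_Cons')
qed simp

lemma counter_value_less:
  assumes "x \<in> configs 2 n"
  shows "counter_value x < 2 ^ n"
proof -
  have "set x \<subseteq> {..<2} \<Longrightarrow> counter_value x < 2 ^ length x" by (induction x) auto
  then show ?thesis using assms by (auto simp: configs_def)
qed

lemma counter_value_inj: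
  assumes "counter_value x = counter_value y" "x \<in> configs 2 n" "y \<in> configs 2 n"
  shows "x = y"
  using assms
proof (induction n arbitrary: x y)
  case (Suc n)
  then obtain b x' c y' where [simp]: "x = b # x'" "y = c # y'"
    by (auto simp: configs_def length_Suc_conv)
  have bc: "b < 2" "c < 2" "b + 2 * counter_value x' = c + 2 * counter_value y'"
    using Suc.prems by (auto simp: configs_def)
  then have "b = c" by presburger
  then show ?case using Suc bc by (auto simp: configs_def)
qed (simp add: configs_def)

text \<open>The modulus reflects the dropped carry. If the lowest bit is 1, the claim is twice the
  one for the tail.\<close>

lemma counter_value_increment:
  assumes "set x \<subseteq> {..<2}"
  shows "counter_value (increment x) mod 2 ^ length x = (counter_value x + 1) mod 2 ^ length x"
  using assms
proof (induction x)
  case (Cons b x)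
  then have "b = 0 \<or> b = 1" by auto
  then show ?case
  proof
    assume b: "b = 1"
    have "counter_value (increment (b # x)) mod 2 ^ length (b # x)
      = 2 * (counter_value (increment x) mod 2 ^ length x)"
      using b by (simp add: mod_mult_mult1)
    also have "\<dots> = 2 * ((counter_value x + 1) mod 2 ^ length x)" using Cons by simp
    also have "\<dots> = (2 * (counter_value x + 1)) mod (2 * 2 ^ length x)"
      by (rule mod_mult_mult1[symmetric])
    also have "\<dots> = (counter_value (b # x) + 1) mod 2 ^ length (b # x)"
      using b by simp
    finally show ?thesis .
  qed simp
qed simp

lemma counter_value_funpow:
  assumes "x \<in> configs 2 n"
  shows "counter_value ((increment ^^ t) x) mod 2 ^ n = (counter_value x + t) mod 2 ^ n"
proof (induction t)
  case (Suc t)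
  have "(increment ^^ t) x \<in> configs 2 n"
    using assms automata_network_increment by (rule funpow_configs[rotated])
  then have "counter_value ((increment ^^ Suc t) x) mod 2 ^ n
      = (counter_value ((increment ^^ t) x) + 1) mod 2 ^ n"
    using counter_value_increment by (auto simp: configs_def)
  also have "\<dots> = (counter_value x + Suc t) mod 2 ^ n"
    using Suc mod_add_cong[of _ "2 ^ n" _ 1 1] by fastforce
  finally show ?case .
qed simp

text \<open>Values below \<open>2 ^ n\<close> determine configurations, and \<open>t\<close> steps
  add \<open>t\<close> modulo \<open>2 ^ n\<close>.\<close>

lemma increment_period_iff:
  assumes "x \<in> configs 2 n"
  shows "(increment ^^ t) x = x \<longleftrightarrow> 2 ^ n dvd t"
proof -
  have conf: "(increment ^^ t) x \<in> configs 2 n"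
    using assms automata_network_increment by (rule funpow_configs[rotated])
  have "counter_value x < 2 ^ n" "counter_value ((increment ^^ t) x) < 2 ^ n"
    using conf assms counter_value_less by blast+
  then have "(increment ^^ t) x = x
      \<longleftrightarrow> counter_value ((increment ^^ t) x) mod 2 ^ n = counter_value x mod 2 ^ n"
    using counter_value_inj[OF _ conf assms] by auto
  also have "\<dots> \<longleftrightarrow> (counter_value x + t) mod 2 ^ n = counter_value x mod 2 ^ n"
    by (simp add: counter_value_funpow[OF assms])
  also have "\<dots> \<longleftrightarrow> 2 ^ n dvd t"
    using mod_eq_dvd_iff_nat[of "counter_value x" "counter_value x + t" "2 ^ n"] by auto
  finally show ?thesis .
qed

section \<open>Circuits\<close>

definition wires :: "bgate list \<Rightarrow> bool list \<Rightarrow> bool list" where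
  "wires gs inp = foldl (\<lambda>ws g. ws @ [bgate_eval ws g]) inp gs"

lemma length_wires [simp]: "length (wires gs inp) = length inp + length gs"
  unfolding wires_def by (induction gs arbitrary: inp) auto

lemma wires_snoc: "wires (gs @ [g]) inp = wires gs inp @ [bgate_eval (wires gs inp) g]"
  by (simp add: wires_def)

text \<open>One gate list computes a whole set of functions, so intermediate results are shared and
  each new gate counts once, however often it is read.\<close>

definition realizable :: "nat \<Rightarrow> nat \<Rightarrow> (bool list \<Rightarrow> bool) set \<Rightarrow> bool" where
  "realizable N s A \<longleftrightarrow>
     (\<exists>gs. length gs \<le> s \<and>
       (\<forall>i < length gs. bgate_args (gs ! i) \<subseteq> {..<N + i}) \<and>
       (\<forall>f \<in> A. \<exists>w < N + length gs. \<forall>inp. length inp = N \<longrightarrow> wires gs inp ! w = f inp))"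

lemma realizable_inputs: "realizable N 0 ((\<lambda>i inp. inp ! i) ` {..<N})"
  by (auto simp: realizable_def wires_def)

lemma realizable_mono: "realizable N s A \<Longrightarrow> B \<subseteq> A \<Longrightarrow> s \<le> s' \<Longrightarrow> realizable N s' B"
  unfolding realizable_def by (elim exE, rule exI) (auto intro: order_trans)

text \<open>Appending a gate changes neither the numbers nor the values of earlier wires.\<close>

lemma realizable_snoc:
  assumes "length gs \<le> s" "\<forall>i < length gs. bgate_args (gs ! i) \<subseteq> {..<N + i}"
    and A: "\<forall>f \<in> A. \<exists>w < N + length gs. \<forall>inp. length inp = N \<longrightarrow> wires gs inp ! w = f inp"
    and g: "bgate_args g \<subseteq> {..<N + length gs}"
      "\<And>inp. length inp = N \<Longrightarrow> bgate_eval (wires gs inp) g = h inp"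
  shows "realizable N (Suc s) (insert h A)"
  unfolding realizable_def
proof (intro exI[of _ "gs @ [g]"] conjI ballI)
  show "length (gs @ [g]) \<le> Suc s" using assms by simp
  show "\<forall>i < length (gs @ [g]). bgate_args ((gs @ [g]) ! i) \<subseteq> {..<N + i}"
    using assms(2) g(1) by (auto simp: nth_append less_Suc_eq)
  fix f assume "f \<in> insert h A"
  then consider "f = h" | "f \<in> A" by blast
  then show "\<exists>w < N + length (gs @ [g]). \<forall>inp. length inp = N \<longrightarrow> wires (gs @ [g]) inp ! w = f inp"
  proof cases
    case 1
    then show ?thesis using g(2) by (intro exI[of _ "N + length gs"]) (auto simp: wires_snoc nth_append)
  next
    case 2
    then obtain w where "w < N + length gs" "\<forall>inp. length inp = N \<longrightarrow> wires gs inp ! w = f inp"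
      using A by blast
    then show ?thesis by (intro exI[of _ w]) (auto simp: wires_snoc nth_append)
  qed
qed

lemma realizable_not:
  assumes "realizable N s A" "f \<in> A"
  shows "realizable N (Suc s) (insert (\<lambda>inp. \<not> f inp) A)"
proof -
  obtain gs where gs: "length gs \<le> s" "\<forall>i < length gs. bgate_args (gs ! i) \<subseteq> {..<N + i}"
    "\<forall>f \<in> A. \<exists>w < N + length gs. \<forall>inp. length inp = N \<longrightarrow> wires gs inp ! w = f inp"
    using assms(1) unfolding realizable_def by blast
  then obtain w where "w < N + length gs" "\<forall>inp. length inp = N \<longrightarrow> wires gs inp ! w = f inp"
    using assms(2) by blast
  then show ?thesis by (intro realizable_snoc[OF gs, of "NotGate w"]) auto
qed

lemma realizable_and_or:
  assumes "realizable N s A" "f \<in> A" "f' \<in> A"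
  shows "realizable N (Suc s) (insert (\<lambda>inp. f inp \<and> f' inp) A)"
    and "realizable N (Suc s) (insert (\<lambda>inp. f inp \<or> f' inp) A)"
proof -
  obtain gs where gs: "length gs \<le> s" "\<forall>i < length gs. bgate_args (gs ! i) \<subseteq> {..<N + i}"
    "\<forall>f \<in> A. \<exists>w < N + length gs. \<forall>inp. length inp = N \<longrightarrow> wires gs inp ! w = f inp"
    using assms(1) unfolding realizable_def by blast
  obtain w where w: "w < N + length gs" "\<forall>inp. length inp = N \<longrightarrow> wires gs inp ! w = f inp"
    using gs(3) assms(2) by blast
  obtain w' where w': "w' < N + length gs" "\<forall>inp. length inp = N \<longrightarrow> wires gs inp ! w' = f' inp"
    using gs(3) assms(3) by blast
  show "realizable N (Suc s) (insert (\<lambda>inp. f inp \<and> f' inp) A)"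
    using w w' by (intro realizable_snoc[OF gs, of "AndGate w w'"]) auto
  show "realizable N (Suc s) (insert (\<lambda>inp. f inp \<or> f' inp) A)"
    using w w' by (intro realizable_snoc[OF gs, of "OrGate w w'"]) auto
qed

text \<open>Outputs are references to wires, and several may share a wire, so their number
  \<open>l\<close> does not enter the size.\<close>

lemma circuit_of_realizable:
  assumes "realizable N s A" "\<And>i. i < l \<Longrightarrow> out i \<in> A"
  obtains C where "wf_circuit C" "c_inputs C = N" "length (c_outputs C) = l" "circuit_size C \<le> s"
    "\<And>inp. length inp = N \<Longrightarrow> circuit_eval C inp = map (\<lambda>i. out i inp) [0..<l]"
proof -
  obtain gs where gs: "length gs \<le> s" "\<forall>i < length gs. bgate_args (gs ! i) \<subseteq> {..<N + i}"
    "\<forall>f \<in> A. \<exists>w < N + length gs. \<forall>inp. length inp = N \<longrightarrow> wires gs inp ! w = f inp"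
    using assms(1) unfolding realizable_def by blast
  have "\<forall>i. \<exists>w. i < l \<longrightarrow>
      w < N + length gs \<and> (\<forall>inp. length inp = N \<longrightarrow> wires gs inp ! w = out i inp)"
    using gs(3) assms(2) by blast
  then obtain w where w: "\<And>i. i < l \<Longrightarrow> w i < N + length gs"
    "\<And>i inp. i < l \<Longrightarrow> length inp = N \<Longrightarrow> wires gs inp ! w i = out i inp"
    by metis
  show ?thesis
    by (rule that[of "\<lparr>c_inputs = N, c_gates = gs, c_outputs = map w [0..<l]\<rparr>"])
      (use gs w in \<open>auto simp: wf_circuit_def circuit_size_def circuit_eval_def wires_def[symmetric]\<close>)
qed

text \<open>A ripple-carry circuit: the prefix conjunction is the carry into cell \<open>i\<close>,
  and \<open>c\<close> is the value of the read wire that stands for state 1. Three gates make the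
  constants, eight serve each cell. Constants and negations are included because a bit of an
  arbitrary code may be any such function of the new state.\<close>

lemma realizable_increment:
  assumes inputs: "\<And>i. i < n \<Longrightarrow> pos i < N" and "n > 0"
    and b: "\<And>i. b i = (\<lambda>inp. inp ! pos i = c)"
  shows "realizable N (3 + 8 * n) ({\<lambda>_. True, \<lambda>_. False} \<union>
    (\<Union>i<n. {\<lambda>inp. b i inp \<noteq> (\<forall>j<i. b j inp), \<lambda>inp. b i inp = (\<forall>j<i. b j inp)}))"
proof -
  define inp where "inp = (\<lambda>i (inp :: bool list). inp ! i) ` {..<N}"
  define pre where "pre i = (\<lambda>inp. \<forall>j<i. b j inp)" for i
  define new where "new i = {\<lambda>inp. b i inp \<noteq> pre i inp, \<lambda>inp. b i inp = pre i inp}" for i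
  define base where "base = {\<lambda>_. True, \<lambda>_. False} \<union> inp"
  have pos: "(\<lambda>inp. inp ! pos i) \<in> inp" if "i < n" for i
    using inputs[OF that] by (auto simp: inp_def)
  have "realizable N (3 + 8 * i) (base \<union> (\<Union>j<i. new j) \<union> {pre i})" if "i \<le> n" for i
    using that
  proof (induction i)
    case 0
    \<comment> \<open>There are no constant gates: \<open>True\<close> is made as a disjunction of
      an input wire, available as \<open>n > 0\<close>, and its negation. It is also the initial
      carry \<open>pre 0\<close>.\<close>
    let ?x = "\<lambda>inp :: bool list. inp ! pos 0"
    have x: "?x \<in> inp" using pos \<open>n > 0\<close> by blast
    have "realizable N 0 inp" unfolding inp_def by (rule realizable_inputs)
    from realizable_not[OF this x]
    have "realizable N (Suc 0) (insert (\<lambda>inp. \<not> ?x inp) inp)" .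
    from realizable_and_or(2)[OF this, of ?x "\<lambda>inp. \<not> ?x inp"] x
    have "realizable N (Suc (Suc 0)) (insert (\<lambda>_. True) (insert (\<lambda>inp. \<not> ?x inp) inp))"
      by simp
    from realizable_not[OF this, of "\<lambda>_. True"]
    have "realizable N 3 (insert (\<lambda>_. False) (insert (\<lambda>_. True) (insert (\<lambda>inp. \<not> ?x inp) inp)))"
      by (simp add: numeral_3_eq_3)
    then show ?case by (rule realizable_mono) (auto simp: base_def pre_def)
  next
    case (Suc i)
    define A where "A = base \<union> (\<Union>j<i. new j) \<union> {pre i}"
    let ?x = "\<lambda>inp :: bool list. inp ! pos i"
    let ?s = "3 + 8 * i"
    have x: "?x \<in> A" using pos[of i] Suc.prems by (simp add: A_def base_def)
    have "realizable N ?s A" using Suc by (simp add: A_def)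
    from realizable_not[OF this x]
    have "realizable N (Suc ?s) (insert (\<lambda>inp. \<not> ?x inp) A)" .
    moreover have "b i \<in> insert (\<lambda>inp. \<not> ?x inp) A"
      using x by (cases c) (simp_all add: b)
    ultimately have 1: "realizable N (Suc ?s) (insert (b i) A)"
      by (elim realizable_mono) auto
    have 2: "realizable N (Suc (Suc ?s)) (insert (\<lambda>inp. \<not> b i inp) (insert (b i) A))"
      by (rule realizable_not[OF 1]) simp
    define A2 where "A2 = insert (\<lambda>inp. \<not> b i inp) (insert (b i) A)"
    have 3: "realizable N (Suc (Suc (Suc ?s))) (insert (\<lambda>inp. \<not> pre i inp) A2)"
      unfolding A2_def by (rule realizable_not[OF 2]) (simp add: A_def)
    define A3 where "A3 = insert (\<lambda>inp. \<not> pre i inp) A2"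
    have mem: "b i \<in> A3" "pre i \<in> A3" "(\<lambda>inp. \<not> b i inp) \<in> A3" "(\<lambda>inp. \<not> pre i inp) \<in> A3"
      by (simp_all add: A3_def A2_def A_def)
    \<comment> \<open>The last five gates: the next carry \<open>pre (Suc i)\<close>, two
      conjunctions and a disjunction forming the exclusive or of \<open>b i\<close> and
      \<open>pre i\<close>, and its negation.\<close>
    note 4 = realizable_and_or(1)[OF 3[folded A3_def] mem(1,2)]
    note 5 = realizable_and_or(1)[OF 4 insertI2[OF mem(1)] insertI2[OF mem(4)]]
    note 6 = realizable_and_or(1)[OF 5 insertI2[OF insertI2[OF mem(3)]] insertI2[OF insertI2[OF mem(2)]]]
    note 7 = realizable_and_or(2)[OF 6 insertI1 insertI2[OF insertI1]]
    note 8 = realizable_not[OF 7 insertI1]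
    have eq: "(\<lambda>inp. b i inp \<and> pre i inp) = pre (Suc i)"
      "(\<lambda>inp. \<not> b i inp \<and> pre i inp \<or> b i inp \<and> \<not> pre i inp) = (\<lambda>inp. b i inp \<noteq> pre i inp)"
      "(\<lambda>inp. \<not> (\<not> b i inp \<and> pre i inp \<or> b i inp \<and> \<not> pre i inp)) = (\<lambda>inp. b i inp = pre i inp)"
      by (auto simp: pre_def less_Suc_eq)
    show ?case
      by (rule realizable_mono[OF 8[unfolded eq]])
        (auto simp: A3_def A2_def A_def new_def lessThan_Suc)
  qed
  from this[OF order_refl] show ?thesis
    by (rule realizable_mono) (auto simp: base_def new_def pre_def)
qed

lemma length_encode_config:
  assumes "alphabet_code k m" "x \<in> configs q n"
  shows "length (encode_config m q x) = n * k q"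
proof -
  have "set x \<subseteq> {..<q} \<Longrightarrow> length (encode_config m q x) = length x * k q"
    using assms(1) by (induction x) (auto simp: encode_config_def alphabet_code_def)
  then show ?thesis using assms(2) by (auto simp: configs_def)
qed

lemma nth_encode_config:
  assumes "alphabet_code k m" "x \<in> configs q n" "i < n" "r < k q"
  shows "encode_config m q x ! (i * k q + r) = m q (x ! i) ! r"
proof -
  have "set x \<subseteq> {..<q} \<Longrightarrow> i < length x \<Longrightarrow> encode_config m q x ! (i * k q + r) = m q (x ! i) ! r"
  proof (induction x arbitrary: i)
    case (Cons c x)
    have "length (m q c) = k q" using assms(1) Cons.prems by (simp add: alphabet_code_def)
    then show ?case using Cons assms(4)
      by (cases i) (auto simp: encode_config_def nth_append)
  qed simp
  then show ?thesis using assms by (auto simp: configs_def)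
qed

text \<open>The code is arbitrary, so each cell is read at one position \<open>r\<close> where the
  code words of 0 and 1 differ. The size does not depend on the code length.\<close>

lemma increment_circuit:
  assumes code: "alphabet_code k m" and "n > 0"
  obtains C where "circuit_encoding k m 2 n increment C" "circuit_size C \<le> 3 + 8 * n"
proof -
  define K where "K = k 2"
  have K: "K > 0" "length (m 2 0) = K" "length (m 2 1) = K" 
    using code by (auto simp: K_def alphabet_code_def)
  have "inj_on (m 2) {..<2}" using code by (simp add: alphabet_code_def)
  then have "m 2 0 \<noteq> m 2 1" using inj_onD[of "m 2" "{..<2}" 0 1] by force
  with K obtain r where r: "r < K" "m 2 0 ! r \<noteq> m 2 1 ! r"
    using nth_equalityI[of "m 2 0" "m 2 1"] by auto
  define b where "b i = (\<lambda>inp. inp ! (i * K + r) = m 2 1 ! r)" for i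
  have less: "i * K + r < n * K" if "i < n" "r < K" for i r
  proof -
    have "i * K + r < Suc i * K" using that by simp
    also have "\<dots> \<le> n * K" using that by (intro mult_le_mono1) simp
    finally show ?thesis .
  qed
  note real = realizable_increment[of n "\<lambda>i. i * K + r" "n * K" b "m 2 1 ! r", OF less[OF _ r(1)]
      \<open>n > 0\<close> b_def]
  \<comment> \<open>Output \<open>l\<close> is bit \<open>l mod K\<close> of the code word of the
    new state of cell \<open>l div K\<close>.\<close>
  define out where "out l = (\<lambda>inp.
      m 2 (if b (l div K) inp \<noteq> (\<forall>j < l div K. b j inp) then 1 else 0) ! (l mod K))" for l
  obtain C where C: "wf_circuit C" "c_inputs C = n * K" "length (c_outputs C) = n * K"
    "circuit_size C \<le> 3 + 8 * n"
    "\<And>inp. length inp = n * K \<Longrightarrow> circuit_eval C inp = map (\<lambda>l. out l inp) [0..<n * K]"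
  proof (rule circuit_of_realizable[OF real, of "n * K" out])
    fix l assume "l < n * K"
    then have l: "l div K < n" using K by (simp add: less_mult_imp_div_less)
    let ?new = "\<lambda>inp. b (l div K) inp \<noteq> (\<forall>j < l div K. b j inp)"
    \<comment> \<open>A function of a single bit is constant, the bit itself or its
      negation.\<close>
    have "out l \<in> {\<lambda>_. True, \<lambda>_. False, ?new, \<lambda>inp. \<not> ?new inp}"
      by (cases "m 2 1 ! (l mod K)"; cases "m 2 0 ! (l mod K)") (auto simp: out_def fun_eq_iff)
    then show "out l \<in> {\<lambda>_. True, \<lambda>_. False} \<union>
      (\<Union>i<n. {\<lambda>inp. b i inp \<noteq> (\<forall>j<i. b j inp), \<lambda>inp. b i inp = (\<forall>j<i. b j inp)})"
      using l by auto
  qed auto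
  have "encode_config m 2 (increment x) = circuit_eval C (encode_config m 2 x)"
    if x: "x \<in> configs 2 n" for x
  proof (rule nth_equalityI)
    have x': "increment x \<in> configs 2 n"
      using automata_network_increment x by (auto simp: automata_network_def)
    have len: "length (encode_config m 2 x) = n * K"
      using length_encode_config[OF code x] by (simp add: K_def)
    show "length (encode_config m 2 (increment x)) = length (circuit_eval C (encode_config m 2 x))"
      using length_encode_config[OF code x'] by (simp add: K_def[symmetric] C(5) len)
    fix l assume "l < length (encode_config m 2 (increment x))"
    then have l: "l < n * K" using length_encode_config[OF code x'] by (simp add: K_def)
    define i where "i = l div K"
    have i: "i < n" using l K by (simp add: i_def less_mult_imp_div_less)
    have b: "b j (encode_config m 2 x) \<longleftrightarrow> x ! j = 1" if "j < n" for j
    proof -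
      have "x ! j \<in> {0, 1}" using x that by (auto simp: configs_def subset_iff less_2_cases_iff)
      then show ?thesis
        using nth_encode_config[OF code x that, of r] r by (auto simp: b_def K_def)
    qed
    have "encode_config m 2 (increment x) ! l = m 2 (increment x ! i) ! (l mod K)"
      using nth_encode_config[OF code x' i, of "l mod K"] K by (simp add: K_def i_def)
    also have "increment x ! i
        = (if b i (encode_config m 2 x) \<noteq> (\<forall>j<i. b j (encode_config m 2 x)) then 1 else 0)"
    proof -
      have "x ! i = 0 \<or> x ! i = 1" using x i by (auto simp: configs_def subset_iff less_2_cases_iff)
      moreover have "(\<forall>j<i. b j (encode_config m 2 x)) \<longleftrightarrow> (\<forall>j<i. x ! j = 1)" using b i by auto
      ultimately show ?thesis using nth_increment[of x i] x i b[OF i] by (auto simp: configs_def)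
    qed
    also have "m 2 \<dots> ! (l mod K) = circuit_eval C (encode_config m 2 x) ! l"
      using l by (simp add: C(5) len out_def i_def)
    finally show "encode_config m 2 (increment x) ! l = circuit_eval C (encode_config m 2 x) ! l" .
  qed
  then have "circuit_encoding k m 2 n increment C"
    using C by (simp add: circuit_encoding_def K_def)
  then show ?thesis using C(4) that by blast
qed

section \<open>Block embeddings\<close>

lemma nth_embed:
  assumes "block_embedding qF n qG N D p" "i < n" "v \<in> D i"
  shows "v < N" "embed n N D p x ! v = p i (x ! i) v"
proof -
  show v: "v < N" using assms by (auto simp: block_embedding_def)
  have "(THE i. i < n \<and> v \<in> D i) = i"
    using assms by (intro the_equality) (auto simp: block_embedding_def disjoint_family_on_def)
  then show "embed n N D p x ! v = p i (x ! i) v" using v by (simp add: embed_def)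
qed

lemma embed_in_configs:
  assumes "block_embedding qF n qG N D p" "x \<in> configs qF n"
  shows "embed n N D p x \<in> configs qG N"
proof -
  have "embed n N D p x ! v < qG" if "v < N" for v
  proof -
    have "v \<in> (\<Union>i<n. D i)" using assms(1) that by (simp add: block_embedding_def)
    then obtain i where "i < n" "v \<in> D i" by blast
    then show ?thesis using nth_embed(2)[OF assms(1)] assms
      by (auto simp: block_embedding_def configs_def subset_iff)
  qed
  moreover have "length (embed n N D p x) = N" by (simp add: embed_def)
  ultimately show ?thesis by (auto simp: configs_def in_set_conv_nth)
qed

text \<open>Restricted to \<open>D i\<close>, an embedded configuration is the pattern of
  \<open>x ! i\<close>, which determines that state.\<close>

lemma inj_on_embed:
  assumes "block_embedding qF n qG N D p"
  shows "inj_on (embed n N D p) (configs qF n)"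
proof (rule inj_onI, rule nth_equalityI)
  fix x y assume x: "x \<in> configs qF n" and y: "y \<in> configs qF n"
    and eq: "embed n N D p x = embed n N D p y"
  show "length x = length y" using x y by (simp add: configs_def)
  fix i assume "i < length x"
  then have i: "i < n" using x by (simp add: configs_def)
  have "restrict (p i (x ! i)) (D i) = restrict (p i (y ! i)) (D i)"
    using nth_embed(2)[OF assms i] eq by (metis restrict_ext)
  moreover have "x ! i < qF" "y ! i < qF" using x y i by (auto simp: configs_def subset_iff)
  ultimately show "x ! i = y ! i" using assms i by (auto simp: block_embedding_def inj_on_def)
qed

lemma simulates_via_funpow:
  assumes "simulates_via q n G F \<phi> T" "automata_network q n F" "x \<in> configs q n"
  shows "\<phi> ((F ^^ t) x) = (G ^^ (T * t)) (\<phi> x)"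
proof (induction t)
  case (Suc t)
  have "\<phi> ((F ^^ Suc t) x) = (G ^^ T) (\<phi> ((F ^^ t) x))"
    using assms funpow_configs[OF assms(2,3)] by (simp add: simulates_via_def)
  then show ?case using Suc by (simp add: funpow_add)
qed simp

section \<open>Exponential periods against polynomial space\<close>

text \<open>The bound \<open>C * (n + 1) ^ d\<close> reduces the claim to one power against an
  exponential; the shift by 1 keeps powers at least 1, so that they absorb constant
  coefficients.\<close>

lemma poly_less_two_power: "\<exists>n>0. poly (P :: nat poly) n < 2 ^ n"
proof -
  have "\<exists>C d. \<forall>n. poly P n \<le> C * (n + 1) ^ d"
  proof (induction P)
    case (pCons c P)
    then obtain C d where Cd: "\<And>n. poly P n \<le> C * (n + 1) ^ d" by blast
    have "poly (pCons c P) n \<le> (c + C) * (n + 1) ^ Suc d" for n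
    proof -
      have "c \<le> c * (n + 1) ^ Suc d"
        using mult_le_mono2[OF one_le_power[of "n + 1" "Suc d"], of c] by simp
      moreover have "n * poly P n \<le> (n + 1) * (C * (n + 1) ^ d)"
        using Cd by (intro mult_mono) auto
      ultimately show ?thesis by (simp add: algebra_simps)
    qed
    then show ?case by blast
  qed simp
  then obtain C d where Cd: "\<And>n. poly P n \<le> C * (n + 1) ^ d" by blast
  have "eventually (\<lambda>n::nat. real C * (real n + 1) ^ d < 2 ^ n) at_top"
    by real_asymp
  then have "eventually (\<lambda>n::nat. real C * (real n + 1) ^ d < 2 ^ n \<and> n > 0) at_top"
    using eventually_gt_at_top by (rule eventually_conj)
  then obtain n :: nat where n: "real C * (real n + 1) ^ d < 2 ^ n" "n > 0"
    by (metis (mono_tags, lifting) eventually_happens' sequentially_bot)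
  then have "real (C * (n + 1) ^ d) < real (2 ^ n)" by (simp add: add.commute)
  then have "C * (n + 1) ^ d < 2 ^ n" unfolding of_nat_less_iff .
  then show ?thesis using Cd[of n] n(2) by (meson le_less_trans)
qed

text \<open>By injectivity of the embedding, a return of the simulating orbit after
  \<open>T * t\<close> steps is a return of the counter after \<open>t\<close> steps. Hence
  \<open>2 ^ n\<close> divides the common period \<open>L\<close>.\<close>

lemma G_t_network_simulating_increment:
  assumes F: "gate_network 3 G_t N F" and emb: "block_embedding 2 n 3 N D p"
    and sim: "simulates_via 2 n F increment (embed n N D p) T" and "n > 0"
  shows "2 ^ n \<le> N * N"
proof -
  let ?\<phi> = "embed n N D p"
  define x where "x = replicate n (0::nat)"
  have x: "x \<in> configs 2 n" by (auto simp: x_def configs_def)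
  have sim': "?\<phi> ((increment ^^ t) x) = (F ^^ (T * t)) (?\<phi> x)" for t
    using simulates_via_funpow[OF sim automata_network_increment x] .
  have period: "2 ^ n dvd t" if "(F ^^ (T * t)) (?\<phi> x) = ?\<phi> x" for t
  proof -
    have "(increment ^^ t) x = x"
      using inj_on_embed[OF emb] that sim'[of t] x funpow_configs[OF automata_network_increment x]
      by (metis inj_onD)
    then show ?thesis using increment_period_iff[OF x] by simp
  qed
  have "T > 0"
  proof (rule ccontr)
    assume "\<not> T > 0"
    \<comment> \<open>With \<open>T = 0\<close> the orbit would return already for
      \<open>t = 1\<close>.\<close>
    then have "(2::nat) ^ n dvd 1" by (intro period) simp
    then show False using \<open>n > 0\<close> by simp
  qed
  define L where "L = Lcm {1..N * N}"
  have "(F ^^ (T * 2 ^ n)) (?\<phi> x) = ?\<phi> x"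
    using sim'[of "2 ^ n"] increment_period_iff[OF x, of "2 ^ n"] by simp
  moreover have "T * 2 ^ n > 0" using \<open>T > 0\<close> by simp
  moreover have "c dvd L" if "0 < c" "c \<le> N * N" for c
    unfolding L_def using that by (intro dvd_Lcm) simp
  ultimately have L: "(F ^^ L) (?\<phi> x) = ?\<phi> x"
    by (rule G_t_network_period[OF F embed_in_configs[OF emb x]])
  have "(F ^^ (j * L)) (?\<phi> x) = ?\<phi> x" for j
    by (induction j) (simp_all add: funpow_add L)
  \<comment> \<open>Taken at \<open>j = T\<close>: \<open>T * L\<close> steps of \<open>F\<close>
    correspond to \<open>L\<close> steps of the counter.\<close>
  then have "2 ^ n dvd Lcm {1..N * N}" unfolding L_def[symmetric] by (intro period)
  then obtain c where "c \<in> {1..N * N}" "2 ^ n dvd c"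
    using two_power_dvd_Lcm[of "{1..N * N}" n] \<open>n > 0\<close> by auto
  then show ?thesis by (auto dest: dvd_imp_le)
qed

theorem mainTheorem11:
  fixes k :: "nat \<Rightarrow> nat" and m :: "nat \<Rightarrow> nat \<Rightarrow> bool list"
  assumes "alphabet_code k m"
  shows "\<not> universal k m (gate_network_family 3 G_t)"
proof
  \<comment> \<open>The polynomial \<open>3 + 8 * n\<close> is the gate bound of the counter
    circuit.\<close>
  let ?P = "[:3, 8:] :: nat poly"
  assume "universal k m (gate_network_family 3 G_t)"
  then obtain T S where "polynomially_bounded S"
    and sim: "simulates (gate_network_family 3 G_t) (U_family k m 2 ?P) T S"
    unfolding universal_def by (metis zero_less_numeral)
  then obtain R :: "nat poly" where R: "\<And>n. S n \<le> poly R n"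
    by (auto simp: polynomially_bounded_def)
  \<comment> \<open>The square of \<open>R\<close> appears because \<open>2 ^ n\<close> is bounded
    by the square of the number \<open>S n\<close> of nodes.\<close>
  obtain n where n: "n > 0" "poly (R * R) n < 2 ^ n" using poly_less_two_power by blast
  obtain C where C: "circuit_encoding k m 2 n increment C" "circuit_size C \<le> 3 + 8 * n"
    using increment_circuit[OF assms n(1)] .
  have "fam_member (U_family k m 2 ?P) n increment"
    "fam_repr (U_family k m 2 ?P) (circuit_word C) n increment"
    using C automata_network_increment by (auto simp: U_family_def mult.commute)
  then obtain F D p where "fam_member (gate_network_family 3 G_t) (S n) F"
    "block_embedding (fam_alphabet (U_family k m 2 ?P)) n
       (fam_alphabet (gate_network_family 3 G_t)) (S n) D p"
    "simulates_via (fam_alphabet (U_family k m 2 ?P)) n F increment (embed n (S n) D p) (T n)"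
    using sim unfolding simulates_def by metis
  then have "gate_network 3 G_t (S n) F" "block_embedding 2 n 3 (S n) D p"
    "simulates_via 2 n F increment (embed n (S n) D p) (T n)"
    by (simp_all add: gate_network_family_def U_family_def)
  then have "2 ^ n \<le> S n * S n" using n(1) by (rule G_t_network_simulating_increment)
  also have "\<dots> \<le> poly (R * R) n" using R by (simp add: mult_le_mono)
  finally show False using n(2) by simp
qed

end
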